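(* For every pair of real numbers $\beta>0$ and $\sigma>0$ there exists a constant $c(\beta,\sigma)>0$, depending only on $\beta$ and $\sigma$, such that the following holds. Let $D\subset\mathbb{R}^2$ be a convex compact set with non-empty interior, let $\boldsymbol{x}\in D\setminus\partial D$, let $\boldsymbol{u}\in\mathbb{R}^2$ be a unit vector, let $\boldsymbol{v}$ be one of the two unit vectors orthogonal to $\boldsymbol{u}$, and let $n\ge 1$ be an integer. Set $\delta=\max\{q\in\mathbb{R}:\boldsymbol{x}+q\boldsymbol{u}\in D\}$ and, for $i=1,2$ and $0<t\le\beta$, $$l_i(t)=\max\{s\in\mathbb{R}:\boldsymbol{x}+(\delta-t)\boldsymbol{u}+(-1)^i s\boldsymbol{v}\in D\},$$ with the convention $\max\emptyset=-\infty$. If $\sigma n^{-2}<\delta<\beta/2$, then $$\lambda_n(D,\boldsymbol{x})\ge c(\beta,\sigma)\, n^{-2}\sqrt{\delta}\,\min_{i=1,2}\ \min_{\delta/2\le t\le\beta}\frac{l_i(t)}{\sqrt{t}}.$$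
   Context: $\partial D$ denotes the boundary of $D$. $\mathcal{P}_n$ denotes the space of all real algebraic polynomials of total degree $\le n$ in two variables. For a compact set $D\subset\mathbb{R}^2$ with non-empty interior, the Christoffel function (with uniform weight $w\equiv1$) is $$\lambda_n(D,\boldsymbol{x})=\left(\sum_{k=1}^N\varphi_k(\boldsymbol{x})^2\right)^{-1},\quad \boldsymbol{x}\in D,$$ where $\{\varphi_k\}_{k=1}^N$ is any orthonormal basis of $\mathcal{P}_n$ with respect to the inner product $\langle f,g\rangle=\int_D f(\boldsymbol{y})g(\boldsymbol{y})\,d\boldsymbol{y}$. Equivalently, $\lambda_n(D,\boldsymbol{x})=\min\{\int_D f^2(\boldsymbol{y})\,d\boldsymbol{y}: f\in\mathcal{P}_n,\ f(\boldsymbol{x})=1\}$. *)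

theory Defs
  imports "HOL-Analysis.Analysis"
begin

definition poly_fun :: "nat \<Rightarrow> (real^2 \<Rightarrow> real) set" where
  "poly_fun n = {f. \<exists>c :: nat \<Rightarrow> nat \<Rightarrow> real.
     \<forall>y. f y = (\<Sum>i\<le>n. \<Sum>j\<le>n - i. c i j * (y $ 1) ^ i * (y $ 2) ^ j)}"

definition inner_on :: "(real^2) set \<Rightarrow> (real^2 \<Rightarrow> real) \<Rightarrow> (real^2 \<Rightarrow> real) \<Rightarrow> real" where
  "inner_on D f g = (LINT y:D|lborel. f y * g y)"

text \<open>The linear combinations are written out because \<^typ>\<open>real^2 \<Rightarrow> real\<close> is not an instance
  of \<^class>\<open>real_vector\<close>. Linear independence is a consequence of orthonormality.\<close>

definition is_onb :: "nat \<Rightarrow> (real^2) set \<Rightarrow> (real^2 \<Rightarrow> real) set \<Rightarrow> bool" where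
  "is_onb n D B \<longleftrightarrow> finite B \<and> B \<subseteq> poly_fun n
     \<and> (\<forall>\<phi>\<in>B. \<forall>\<psi>\<in>B. inner_on D \<phi> \<psi> = (if \<phi> = \<psi> then 1 else 0))
     \<and> (\<forall>f\<in>poly_fun n. \<exists>a. \<forall>y. f y = (\<Sum>\<phi>\<in>B. a \<phi> * \<phi> y))"

text \<open>By \<open>christoffel_eq\<close> below, the value does not depend on the choice of the basis.\<close>

definition christoffel :: "nat \<Rightarrow> (real^2) set \<Rightarrow> real^2 \<Rightarrow> real" where
  "christoffel n D x = inverse (\<Sum>\<phi>\<in>(SOME B. is_onb n D B). (\<phi> x)\<^sup>2)"

text \<open>For compact \<open>D\<close> and \<open>x \<in> D\<close> the supremum is a maximum, see \<open>dist_along_max\<close>.\<close>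

definition dist_along :: "(real^2) set \<Rightarrow> real^2 \<Rightarrow> real^2 \<Rightarrow> real" where
  "dist_along D x u = Sup {q. x + q *\<^sub>R u \<in> D}"

text \<open>The values are extended reals, so that the supremum of the empty set is \<open>-\<infinity>\<close>; a supremum over
  a non-empty set is a maximum, see \<open>side_length_max\<close>. If \<open>D\<close> is convex and the values are
  finite for all \<open>t\<close> in a compact interval, they are concave in \<open>t\<close>, hence lower semicontinuous
  there, so the infimum of \<open>side_length D x u v i t / sqrt t\<close> over such an interval of positive
  \<open>t\<close> is a minimum.\<close>

definition side_length ::
  "(real^2) set \<Rightarrow> real^2 \<Rightarrow> real^2 \<Rightarrow> real^2 \<Rightarrow> nat \<Rightarrow> real \<Rightarrow> ereal" where
  "side_length D x u v i t =
     (SUP s\<in>{s. x + (dist_along D x u - t) *\<^sub>R u + ((-1) ^ i * s) *\<^sub>R v \<in> D}. ereal s)"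

lemma poly_fun_continuous: "f \<in> poly_fun n \<Longrightarrow> continuous_on S f"
proof -
  assume "f \<in> poly_fun n"
  then obtain c where "f = (\<lambda>y. \<Sum>i\<le>n. \<Sum>j\<le>n - i. c i j * (y $ 1) ^ i * (y $ 2) ^ j)"
    unfolding poly_fun_def by auto
  then show ?thesis by (auto intro!: continuous_intros)
qed

lemma poly_fun_prod_integrable:
  assumes "compact D" "f \<in> poly_fun n" "g \<in> poly_fun m"
  shows "set_integrable lborel D (\<lambda>y. f y * g y)"
  by (intro borel_integrable_compact[folded set_integrable_def] assms(1) continuous_on_mult
      poly_fun_continuous[OF assms(2)] poly_fun_continuous[OF assms(3)])

lemma onb_expansion:
  assumes D: "compact D" and B: "is_onb n D B" and f: "f \<in> poly_fun n"
  shows "f x = (\<Sum>\<psi>\<in>B. inner_on D f \<psi> * \<psi> x)"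
proof -
  obtain a where a: "\<And>y. f y = (\<Sum>\<phi>\<in>B. a \<phi> * \<phi> y)"
    using B f unfolding is_onb_def by metis
  have fin: "finite B" using B by (simp add: is_onb_def)
  have "inner_on D f \<psi> = a \<psi>" if psi: "\<psi> \<in> B" for \<psi>
  proof -
    have int: "set_integrable lborel D (\<lambda>y. a \<phi> * (\<phi> y * \<psi> y))" if "\<phi> \<in> B" for \<phi>
      using poly_fun_prod_integrable[OF D, of \<phi> n \<psi> n] B that psi
      by (intro set_integrable_mult_right) (auto simp: is_onb_def)
    have "inner_on D f \<psi> = (LINT y:D|lborel. \<Sum>\<phi>\<in>B. a \<phi> * (\<phi> y * \<psi> y))"
      unfolding inner_on_def by (simp add: a sum_distrib_right mult.assoc)
    also have "\<dots> = (\<Sum>\<phi>\<in>B. LINT y:D|lborel. a \<phi> * (\<phi> y * \<psi> y))"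
      using int fin unfolding set_lebesgue_integral_def set_integrable_def
      by (simp only: scaleR_sum_right) (rule Bochner_Integration.integral_sum, simp)
    also have "\<dots> = (\<Sum>\<phi>\<in>B. a \<phi> * inner_on D \<phi> \<psi>)"
      unfolding inner_on_def by simp
    also have "\<dots> = (\<Sum>\<phi>\<in>B. if \<phi> = \<psi> then a \<phi> else 0)"
      using B psi unfolding is_onb_def by (intro sum.cong) auto
    finally show ?thesis using fin psi by simp
  qed
  then show ?thesis using a by simp
qed

lemma christoffel_eq:
  assumes D: "compact D" and B: "is_onb n D B"
  shows "christoffel n D x = inverse (\<Sum>\<phi>\<in>B. (\<phi> x)\<^sup>2)"
proof -
  define C where "C = (SOME B. is_onb n D B)"
  have C: "is_onb n D C" unfolding C_def using B by (rule someI)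
  have BC: "\<phi> \<in> poly_fun n" if "\<phi> \<in> B \<or> \<phi> \<in> C" for \<phi>
    using B C that by (auto simp: is_onb_def)
  have "(\<Sum>\<phi>\<in>C. (\<phi> x)\<^sup>2) = (\<Sum>\<phi>\<in>C. \<phi> x * (\<Sum>\<psi>\<in>B. inner_on D \<phi> \<psi> * \<psi> x))"
    unfolding power2_eq_square
    by (intro sum.cong refl arg_cong2[where f = "(*)"] onb_expansion[OF D B]) (simp add: BC)
  also have "\<dots> = (\<Sum>\<phi>\<in>C. \<Sum>\<psi>\<in>B. \<psi> x * (inner_on D \<psi> \<phi> * \<phi> x))"
    by (simp add: sum_distrib_left inner_on_def mult_ac)
  also have "\<dots> = (\<Sum>\<psi>\<in>B. \<psi> x * (\<Sum>\<phi>\<in>C. inner_on D \<psi> \<phi> * \<phi> x))"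
    by (subst sum.swap) (simp add: sum_distrib_left)
  also have "\<dots> = (\<Sum>\<psi>\<in>B. (\<psi> x)\<^sup>2)"
    unfolding power2_eq_square
    by (intro sum.cong refl arg_cong2[where f = "(*)"] onb_expansion[OF D C, symmetric]) (simp add: BC)
  finally show ?thesis by (simp add: christoffel_def C_def)
qed

lemma compact_line_section:
  fixes p w :: "real^2"
  assumes "compact D" "norm w = 1"
  shows "compact {s. p + s *\<^sub>R w \<in> D}"
proof -
  have "closed ((\<lambda>s. p + s *\<^sub>R w) -` D)"
    by (intro closed_vimage compact_imp_closed assms continuous_intros)
  moreover obtain r where r: "\<And>y. y \<in> D \<Longrightarrow> norm y \<le> r"
    using compact_imp_bounded[OF assms(1)] by (auto simp: bounded_iff)
  have "\<bar>s\<bar> \<le> r + norm p" if "p + s *\<^sub>R w \<in> D" for s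
    using r[OF that] norm_triangle_ineq4[of "p + s *\<^sub>R w" p] assms(2) by simp
  then have "bounded {s. p + s *\<^sub>R w \<in> D}"
    by (auto simp: bounded_iff)
  ultimately show ?thesis by (simp add: compact_eq_bounded_closed vimage_def)
qed

lemma dist_along_max:
  assumes "compact D" "norm u = 1" "x \<in> D"
  shows "x + dist_along D x u *\<^sub>R u \<in> D"
    and "x + q *\<^sub>R u \<in> D \<Longrightarrow> q \<le> dist_along D x u"
proof -
  have c: "compact {q. x + q *\<^sub>R u \<in> D}" by (rule compact_line_section[OF assms(1,2)])
  have bdd: "bdd_above {q. x + q *\<^sub>R u \<in> D}"
    using compact_imp_bounded[OF c] by (rule bounded_imp_bdd_above)
  have "0 \<in> {q. x + q *\<^sub>R u \<in> D}" using assms(3) by simp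
  then have "Sup {q. x + q *\<^sub>R u \<in> D} \<in> {q. x + q *\<^sub>R u \<in> D}"
    by (intro closed_contains_Sup bdd compact_imp_closed[OF c]) blast
  then show "x + dist_along D x u *\<^sub>R u \<in> D" by (simp add: dist_along_def)
  show "q \<le> dist_along D x u" if "x + q *\<^sub>R u \<in> D"
    unfolding dist_along_def using that by (intro cSup_upper bdd) simp
qed

lemma side_length_max:
  assumes "compact D" "norm v = 1"
    and "x + (dist_along D x u - t) *\<^sub>R u + ((-1) ^ i * s) *\<^sub>R v \<in> D"
  obtains m where "side_length D x u v i t = ereal m"
    and "x + (dist_along D x u - t) *\<^sub>R u + ((-1) ^ i * m) *\<^sub>R v \<in> D"
    and "\<And>r. x + (dist_along D x u - t) *\<^sub>R u + ((-1) ^ i * r) *\<^sub>R v \<in> D \<Longrightarrow> r \<le> m"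
proof -
  define S where "S = {s. x + (dist_along D x u - t) *\<^sub>R u + ((-1) ^ i * s) *\<^sub>R v \<in> D}"
  have "compact S"
    using compact_line_section[of D "(-1) ^ i *\<^sub>R v" "x + (dist_along D x u - t) *\<^sub>R u"] assms(1,2)
    by (simp add: S_def power_abs mult.commute)
  moreover have "S \<noteq> {}" using assms(3) by (auto simp: S_def)
  ultimately obtain m where m: "m \<in> S" "\<And>r. r \<in> S \<Longrightarrow> r \<le> m"
    using compact_attains_sup[of S] by blast
  have "side_length D x u v i t = ereal m"
    unfolding side_length_def S_def[symmetric]
    by (rule antisym, rule SUP_least, use m in simp, rule SUP_upper, use m in simp)
  then show thesis using m by (intro that[of m]) (auto simp: S_def)
qed

end

theory Submission
  imports Defs "HOL-Computational_Algebra.Polynomial"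
begin

text \<open>
  By the extremal characterisation (\<open>le_christoffel\<close>) it suffices to bound
  \<open>f(x)\<^sup>2\<close> by a constant times \<open>\<integral>\<^sub>D f\<^sup>2\<close> for every polynomial \<open>f\<close> of degree at most \<open>n\<close>.
  Write \<open>\<delta>\<close> for \<open>dist_along D x u\<close> and use coordinates \<open>(s, t)\<close> for the point
  \<open>x + (\<delta> - t) u + s v\<close>, so that \<open>x = (0, \<delta>)\<close>. If the minimum of the quotients
  \<open>l\<^sub>i(t) / \<surd>t\<close> is not positive, neither is the asserted lower bound. If \<open>M > 0\<close> is a lower bound for
  them, convexity puts the piece of parabola \<open>\<bar>s\<bar> \<le> M \<surd>t\<close>,
  \<open>\<delta>/2 \<le> t \<le> \<beta>\<close> into \<open>D\<close>.

  Inside that piece the two-dimensional estimate splits into two one-dimensional ones. Both are instances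
  of the same inequality for a real polynomial \<open>p\<close> of degree at most \<open>n\<close> and \<open>a < y < b\<close>
  (\<open>poly_christoffel_interval\<close>):
  \<open>\<surd>((y - a) (b - y)) p(y)\<^sup>2\<close> is at most \<open>4 (n + 1) / \<pi>\<close> times the integral of \<open>p\<^sup>2\<close>
  over \<open>[a, b]\<close>.
  It is applied to \<open>f\<close> along the parabola \<open>t = \<delta> + s\<^sup>2/M\<^sup>2\<close>, where \<open>f\<close> has degree at most
  \<open>2n\<close> in \<open>s\<close> and \<open>x\<close> is the midpoint of the parameter interval, at the cost of a factor of order
  \<open>n / (M \<surd>\<beta>)\<close>. It is then applied, for each \<open>s\<close>, on the segment parallel to \<open>u\<close> that begins
  \<open>\<delta>/2\<close> below the parabola and has length \<open>\<beta>/2\<close>, at the cost of a factor of order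
  \<open>n / \<surd>(\<delta> \<beta>)\<close>. These segments stay in \<open>D\<close>, and by Fubini their integrals add up to at most
  \<open>\<integral>\<^sub>D f\<^sup>2\<close>. The product of the two factors is, up to a constant, the reciprocal of
  the asserted bound.

  The one-dimensional inequality is an average of inequalities with Chebyshev weights. For \<open>B > 0\<close> the
  function \<open>p(\<surd>B cos \<theta>)\<close> is a cosine polynomial, whose values are controlled by its \<open>L\<^sup>2\<close>
  norm; this bounds \<open>p(y)\<^sup>2\<close> by the integral of \<open>p(z)\<^sup>2 / \<surd>(B - z\<^sup>2)\<close> as long as
  \<open>y\<^sup>2 \<le> B\<close>. Averaging over \<open>B\<close> in \<open>[y\<^sup>2, 1]\<close> replaces the singular weights by a bounded one, of
  size at most \<open>2 / \<surd>(1 - y\<^sup>2)\<close>.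
\<close>

section \<open>Values of cosine polynomials\<close>

definition cosine_polynomial :: "nat \<Rightarrow> (real \<Rightarrow> real) \<Rightarrow> bool" where
  "cosine_polynomial n f \<longleftrightarrow> (\<exists>a. \<forall>t. f t = (\<Sum>k\<le>n. a k * cos (real k * t)))"

lemma cosine_polynomial_add:
  assumes "cosine_polynomial n f" "cosine_polynomial n g"
  shows "cosine_polynomial n (\<lambda>t. f t + g t)"
proof -
  obtain a b where "\<And>t. f t = (\<Sum>k\<le>n. a k * cos (real k * t))"
    "\<And>t. g t = (\<Sum>k\<le>n. b k * cos (real k * t))"
    using assms unfolding cosine_polynomial_def by metis
  then have "f t + g t = (\<Sum>k\<le>n. (a k + b k) * cos (real k * t))" for t
    by (simp add: distrib_right sum.distrib)
  then show ?thesis unfolding cosine_polynomial_def by metis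
qed

lemma cosine_polynomial_cmult:
  assumes "cosine_polynomial n f"
  shows "cosine_polynomial n (\<lambda>t. c * f t)"
proof -
  obtain a where "\<And>t. f t = (\<Sum>k\<le>n. a k * cos (real k * t))"
    using assms unfolding cosine_polynomial_def by metis
  then have "c * f t = (\<Sum>k\<le>n. (c * a k) * cos (real k * t))" for t
    by (simp add: sum_distrib_left mult.assoc)
  then show ?thesis unfolding cosine_polynomial_def by metis
qed

lemma cosine_polynomial_cos:
  assumes "k \<le> n"
  shows "cosine_polynomial n (\<lambda>t. cos (real k * t))"
proof -
  have "cos (real k * t) = (\<Sum>j\<le>n. of_bool (j = k) * cos (real j * t))" for t
    using assms by (subst sum.mono_neutral_right[of _ "{k}"]) auto
  then show ?thesis
    unfolding cosine_polynomial_def by (intro exI[of _ "\<lambda>j. of_bool (j = k)"]) blast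
qed

lemma cosine_polynomial_sum:
  assumes "finite K" "\<And>k. k \<in> K \<Longrightarrow> cosine_polynomial n (f k)"
  shows "cosine_polynomial n (\<lambda>t. \<Sum>k\<in>K. f k t)"
  using assms
proof (induction K)
  case empty
  then show ?case
    unfolding cosine_polynomial_def by (intro exI[of _ "\<lambda>_. 0"]) simp
qed (auto intro: cosine_polynomial_add)

text \<open>Multiplication by \<open>cos t\<close> raises the degree of a cosine polynomial by at most one, because
  \<open>2 cos t cos (k t) = cos ((k + 1) t) + cos (\<bar>k - 1\<bar> t)\<close>. Horner's scheme turns this into an induction
  over the coefficients of \<open>p\<close>.\<close>

lemma poly_cos_cosine_polynomial:
  assumes "degree p \<le> n"
  shows "cosine_polynomial n (\<lambda>t. poly p (A * cos t))"
  using assms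
proof (induction n arbitrary: p)
  case 0
  then obtain c where "p = [:c:]" using degree_0_id[of p] by (metis le_zero_eq)
  then show ?case
    using cosine_polynomial_cmult[OF cosine_polynomial_cos[of 0 0], of c] by simp
next
  case (Suc n)
  obtain c q where p: "p = pCons c q" by (cases p)
  with Suc.prems have "degree q \<le> n" by (cases "q = 0") auto
  from Suc.IH[OF this] obtain a
    where a: "\<And>t. poly q (A * cos t) = (\<Sum>k\<le>n. a k * cos (real k * t))"
    unfolding cosine_polynomial_def by metis
  have prod: "cos t * cos (real k * t)
      = 1/2 * cos (real (Suc k) * t) + 1/2 * cos (real (if k = 0 then 1 else k - 1) * t)" for k t
    by (cases k) (simp_all add: cos_times_cos algebra_simps add_divide_distrib)
  have "poly p (A * cos t) = c * cos (real 0 * t) + (\<Sum>k\<le>n. (A * a k) *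
       (1/2 * cos (real (Suc k) * t) + 1/2 * cos (real (if k = 0 then 1 else k - 1) * t)))" for t
    unfolding prod[symmetric] by (simp add: p a sum_distrib_left mult_ac)
  moreover have "cosine_polynomial (Suc n) (\<lambda>t. c * cos (real 0 * t) + (\<Sum>k\<le>n. (A * a k) *
       (1/2 * cos (real (Suc k) * t) + 1/2 * cos (real (if k = 0 then 1 else k - 1) * t))))"
    by (intro cosine_polynomial_add cosine_polynomial_cmult cosine_polynomial_sum
        cosine_polynomial_cos) auto
  ultimately show ?case by simp
qed

lemma has_integral_cos_nat:
  "((\<lambda>t. cos (real m * t)) has_integral (if m = 0 then pi else 0)) {0..pi}"
proof (cases "m = 0")
  case True
  then show ?thesis using has_integral_const_real[of "1::real" 0 pi] by simp
next
  case False
  have "((\<lambda>t. cos (real m * t)) has_integral (sin (real m * pi) / m - sin (real m * 0) / m)) {0..pi}"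
    using False
    by (intro fundamental_theorem_of_calculus)
       (auto intro!: derivative_eq_intros simp flip: has_real_derivative_iff_has_vector_derivative)
  then show ?thesis using False by simp
qed

lemma has_integral_cos_times_cos:
  "((\<lambda>t. cos (real j * t) * cos (real k * t)) has_integral
     (if j = k then if j = 0 then pi else pi / 2 else 0)) {0..pi}"
proof -
  have *: "cos (real j * t) * cos (real k * t)
      = (cos (real (nat \<bar>int j - int k\<bar>) * t) + cos (real (j + k) * t)) / 2" for t
  proof (cases "k \<le> j")
    case True
    then show ?thesis
      by (simp add: cos_times_cos of_nat_diff nat_abs_int_diff algebra_simps)
  next
    case False
    have "cos (real j * t) * cos (real k * t) = cos (real k * t) * cos (real j * t)" by simp
    also have "\<dots> = (cos (real (k - j) * t) + cos (real (j + k) * t)) / 2"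
      unfolding cos_times_cos using False by (simp add: of_nat_diff algebra_simps)
    finally show ?thesis using False by (simp add: nat_abs_int_diff)
  qed
  show ?thesis
    unfolding *
    using has_integral_divide[OF has_integral_add[OF
        has_integral_cos_nat[of "nat \<bar>int j - int k\<bar>"] has_integral_cos_nat[of "j + k"]], of 2]
    by (auto split: if_splits)
qed

text \<open>The functions \<open>cos (k t)\<close> are orthogonal on \<open>[0, \<pi>]\<close> with squared norm at least \<open>\<pi>/2\<close>, so
  Parseval's identity bounds the sum of the squared coefficients; the Cauchy--Schwarz inequality for the
  \<open>n + 1\<close> summands at \<open>t\<close> does the rest.\<close>

lemma cosine_polynomial_christoffel:
  assumes "cosine_polynomial n g"
  shows "(g t)\<^sup>2 \<le> 2 * (real n + 1) / pi * integral {0..pi} (\<lambda>s. (g s)\<^sup>2)"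
proof -
  obtain a where a: "\<And>s. g s = (\<Sum>k\<le>n. a k * cos (real k * s))"
    using assms unfolding cosine_polynomial_def by metis
  have sq: "(g s)\<^sup>2 = (\<Sum>j\<le>n. \<Sum>k\<le>n. (a j * a k) * (cos (real j * s) * cos (real k * s)))" for s
    by (simp add: a power2_eq_square sum_product mult_ac)
  have "((\<lambda>s. (g s)\<^sup>2) has_integral
      (\<Sum>j\<le>n. \<Sum>k\<le>n. (a j * a k) * (if j = k then if j = 0 then pi else pi / 2 else 0))) {0..pi}"
    unfolding sq
    by (intro has_integral_sum has_integral_mult_right has_integral_cos_times_cos) auto
  then have "integral {0..pi} (\<lambda>s. (g s)\<^sup>2)
      = (\<Sum>j\<le>n. \<Sum>k\<le>n. (a j * a k) * (if j = k then if j = 0 then pi else pi / 2 else 0))"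
    by (rule integral_unique)
  also have "\<dots> = (\<Sum>j\<le>n. (a j)\<^sup>2 * (if j = 0 then pi else pi / 2))"
    by (intro sum.cong refl, subst sum.mono_neutral_right[of _ "{j}" for j])
       (auto simp: power2_eq_square)
  also have "\<dots> \<ge> (\<Sum>j\<le>n. (a j)\<^sup>2 * (pi / 2))"
    by (intro sum_mono mult_left_mono) auto
  finally have int: "(\<Sum>j\<le>n. (a j)\<^sup>2) * (pi / 2) \<le> integral {0..pi} (\<lambda>s. (g s)\<^sup>2)"
    by (simp only: sum_distrib_right)
  have "(g t)\<^sup>2 \<le> (\<Sum>k\<le>n. (a k)\<^sup>2) * (\<Sum>k\<le>n. (cos (real k * t))\<^sup>2)"
    unfolding a by (rule Cauchy_Schwarz_ineq_sum)
  also have "\<dots> \<le> (\<Sum>k\<le>n. (a k)\<^sup>2) * (\<Sum>k\<le>n. 1)"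
    by (intro mult_left_mono sum_mono sum_nonneg) (auto simp: abs_square_le_1)
  also have "\<dots> = 2 * (real n + 1) / pi * ((\<Sum>k\<le>n. (a k)\<^sup>2) * (pi / 2))"
    by simp
  also have "\<dots> \<le> 2 * (real n + 1) / pi * integral {0..pi} (\<lambda>s. (g s)\<^sup>2)"
    by (intro mult_left_mono int) auto
  finally show ?thesis .
qed

section \<open>The Christoffel function of an interval\<close>

lemma measurable_poly [measurable]: "poly (p :: real poly) \<in> borel_measurable borel"
  by (intro borel_measurable_continuous_onI continuous_intros)

text \<open>The substitution \<open>z = - \<surd>B cos t\<close> carries \<open>dt\<close> to the Chebyshev weight of \<open>[- \<surd>B, \<surd>B]\<close>
  and \<open>p\<close> to a cosine polynomial. The sign makes the substitution increasing.\<close>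

lemma poly_christoffel_chebyshev_weight:
  fixes p :: "real poly"
  assumes n: "degree p \<le> n" and B: "0 < B" and y: "y\<^sup>2 \<le> B"
  shows "ennreal ((poly p y)\<^sup>2) \<le> ennreal (2 * (real n + 1) / pi) *
    (\<integral>\<^sup>+z. ennreal ((poly p z)\<^sup>2 / sqrt (B - z\<^sup>2)) * indicator {- sqrt B..sqrt B} z \<partial>lborel)"
proof -
  define g where "g t = poly p (- sqrt B * cos t)" for t
  have g_cont: "continuous_on S g" for S
    unfolding g_def by (intro continuous_intros)
  have g: "cosine_polynomial n g"
    unfolding g_def using poly_cos_cosine_polynomial[OF n] .
  have "\<bar>y\<bar> \<le> sqrt B" using y by (simp add: real_le_rsqrt)
  then have "- 1 \<le> - y / sqrt B" "- y / sqrt B \<le> 1" using B by (auto simp: field_simps)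
  then have y_eq: "poly p y = g (arccos (- y / sqrt B))" using B by (simp add: g_def)
  have int: "set_integrable lborel {0..pi} (\<lambda>t. (g t)\<^sup>2)"
    unfolding set_integrable_def
    by (intro borel_integrable_compact compact_Icc continuous_intros g_cont)
  have "(\<integral>\<^sup>+t. ennreal ((g t)\<^sup>2) * indicator {0..pi} t \<partial>lborel)
      = (\<integral>\<^sup>+t. ennreal (indicator {0..pi} t *\<^sub>R (g t)\<^sup>2) \<partial>lborel)"
    by (intro nn_integral_cong) (auto split: split_indicator)
  also have "\<dots> = ennreal (integral {0..pi} (\<lambda>t. (g t)\<^sup>2))"
    using int set_borel_integral_eq_integral(2)[OF int]
    by (subst nn_integral_eq_integral) (auto simp: set_integrable_def set_lebesgue_integral_def)
  finally have nn: "(\<integral>\<^sup>+t. ennreal ((g t)\<^sup>2) * indicator {0..pi} t \<partial>lborel)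
      = ennreal (integral {0..pi} (\<lambda>t. (g t)\<^sup>2))" .
  let ?f = "\<lambda>z. (poly p z)\<^sup>2 / sqrt (B - z\<^sup>2)"
  have subst: "(\<integral>\<^sup>+z. ennreal (?f z * indicator {- sqrt B * cos 0..- sqrt B * cos pi} z) \<partial>lborel)
      = (\<integral>\<^sup>+t. ennreal (?f (- sqrt B * cos t) * (sqrt B * sin t) * indicator {0..pi} t) \<partial>lborel)"
    using B
    by (intro nn_integral_substitution)
       (auto intro!: derivative_eq_intros continuous_intros simp: set_borel_measurable_def sin_ge_zero)
  \<comment> \<open>At the two end points the weight is a quotient by zero, hence only the comparison almost everywhere.\<close>
  have "(\<integral>\<^sup>+t. ennreal ((g t)\<^sup>2) * indicator {0..pi} t \<partial>lborel)
      \<le> (\<integral>\<^sup>+t. ennreal (?f (- sqrt B * cos t) * (sqrt B * sin t) * indicator {0..pi} t) \<partial>lborel)"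
  proof (rule nn_integral_mono_AE)
    have "AE t in lborel. t \<noteq> 0 \<and> t \<noteq> pi"
      using AE_lborel_singleton[of 0] AE_lborel_singleton[of pi] by eventually_elim auto
    then show "AE t in lborel. ennreal ((g t)\<^sup>2) * indicator {0..pi} t
        \<le> ennreal (?f (- sqrt B * cos t) * (sqrt B * sin t) * indicator {0..pi} t)"
    proof eventually_elim
      case (elim t)
      show ?case
      proof (cases "t \<in> {0..pi}")
        case True
        with elim have sin: "0 < sin t" by (intro sin_gt_zero) auto
        have "B - (- sqrt B * cos t)\<^sup>2 = B * (sin t)\<^sup>2"
          using B by (simp add: power_mult_distrib cos_squared_eq algebra_simps)
        then have "sqrt (B - (- sqrt B * cos t)\<^sup>2) = sqrt B * sin t"
          using sin by (simp add: real_sqrt_mult)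
        then show ?thesis using sin B True by (simp add: g_def)
      qed simp
    qed
  qed
  also have "\<dots> = (\<integral>\<^sup>+z. ennreal (?f z) * indicator {- sqrt B..sqrt B} z \<partial>lborel)"
    unfolding subst[symmetric] by (intro nn_integral_cong) (auto split: split_indicator)
  finally have le: "ennreal (integral {0..pi} (\<lambda>t. (g t)\<^sup>2))
      \<le> (\<integral>\<^sup>+z. ennreal (?f z) * indicator {- sqrt B..sqrt B} z \<partial>lborel)"
    unfolding nn .
  have "ennreal ((poly p y)\<^sup>2)
      \<le> ennreal (2 * (real n + 1) / pi * integral {0..pi} (\<lambda>t. (g t)\<^sup>2))"
    unfolding y_eq by (intro ennreal_leI cosine_polynomial_christoffel g)
  also have "\<dots> = ennreal (2 * (real n + 1) / pi) * ennreal (integral {0..pi} (\<lambda>t. (g t)\<^sup>2))"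
    by (intro ennreal_mult') simp
  also have "\<dots> \<le> ennreal (2 * (real n + 1) / pi) *
      (\<integral>\<^sup>+z. ennreal (?f z) * indicator {- sqrt B..sqrt B} z \<partial>lborel)"
    by (intro mult_left_mono le) simp
  finally show ?thesis .
qed

text \<open>The substitution \<open>B = z\<^sup>2 + h\<^sup>2\<close> makes the integrand equal to \<open>2\<close>. The value
  \<open>2 (\<surd>(1 - z\<^sup>2) - \<surd>(m - z\<^sup>2))\<close> is then estimated by subadditivity of the square root, which removes
  the dependence on \<open>z\<close>.\<close>

lemma nn_integral_inverse_sqrt_le:
  assumes "z\<^sup>2 \<le> m" "m \<le> 1"
  shows "(\<integral>\<^sup>+B. ennreal (1 / sqrt (B - z\<^sup>2)) * indicator {m..1} B \<partial>lborel) \<le> ennreal (2 * sqrt (1 - m))"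
proof -
  define a b where "a = sqrt (m - z\<^sup>2)" and "b = sqrt (1 - z\<^sup>2)"
  have ab: "0 \<le> a" "a \<le> b" "z\<^sup>2 + a\<^sup>2 = m" "z\<^sup>2 + b\<^sup>2 = 1"
    using assms by (auto simp: a_def b_def)
  have "(\<integral>\<^sup>+B. ennreal (1 / sqrt (B - z\<^sup>2)) * indicator {m..1} B \<partial>lborel)
      = (\<integral>\<^sup>+B. ennreal (1 / sqrt (B - z\<^sup>2) * indicator {z\<^sup>2 + a\<^sup>2..z\<^sup>2 + b\<^sup>2} B) \<partial>lborel)"
    unfolding ab by (intro nn_integral_cong) (auto split: split_indicator)
  also have "\<dots> = (\<integral>\<^sup>+h. ennreal (1 / sqrt (z\<^sup>2 + h\<^sup>2 - z\<^sup>2) * (2 * h) * indicator {a..b} h) \<partial>lborel)"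
    using ab
    by (intro nn_integral_substitution)
       (auto intro!: derivative_eq_intros continuous_intros simp: set_borel_measurable_def)
  also have "\<dots> \<le> (\<integral>\<^sup>+h. ennreal 2 * indicator {a..b} h \<partial>lborel)"
    using ab by (intro nn_integral_mono) (auto split: split_indicator)
  also have "\<dots> = ennreal (2 * (b - a))"
    using ab ennreal_mult'[of 2 "b - a"] by (simp add: nn_integral_cmult right_diff_distrib)
  also have "b - a \<le> sqrt (1 - m)"
    using sqrt_add_le_add_sqrt[of "1 - m" "m - z\<^sup>2"] assms by (simp add: a_def b_def)
  finally show ?thesis by (simp add: ennreal_leI order_trans)
qed

text \<open>Integrating the Chebyshev-weighted bounds over \<open>B \<in> [y\<^sup>2, 1]\<close> multiplies the left-hand side by
  \<open>1 - y\<^sup>2\<close>. By Tonelli the weight on the right-hand side becomes the integral of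
  \<open>1 / \<surd>(B - z\<^sup>2)\<close> over those \<open>B\<close> that are at least \<open>max (y\<^sup>2) (z\<^sup>2)\<close>, which is at most
  \<open>2 \<surd>(1 - y\<^sup>2)\<close>. One factor \<open>\<surd>(1 - y\<^sup>2)\<close> survives the division; a single Chebyshev weight on
  \<open>[-1, 1]\<close> would not give any bound by the unweighted integral.\<close>

lemma poly_christoffel_unit_interval:
  fixes p :: "real poly"
  assumes n: "degree p \<le> n" and y: "\<bar>y\<bar> < 1"
  shows "ennreal (sqrt (1 - y\<^sup>2) * (poly p y)\<^sup>2)
    \<le> ennreal (4 * (real n + 1) / pi) * (\<integral>\<^sup>+z. ennreal ((poly p z)\<^sup>2) * indicator {-1..1} z \<partial>lborel)"
proof -
  define s where "s = sqrt (1 - y\<^sup>2)"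
  have s: "0 < s" "s\<^sup>2 = 1 - y\<^sup>2" using y by (auto simp: s_def abs_square_less_1 abs_square_le_1 less_imp_le)
  define C where "C = 2 * (real n + 1) / pi"
  \<comment> \<open>The open lower end excludes \<open>B = 0\<close>, which would occur for \<open>y = 0\<close>.\<close>
  define F where "F B z = (if y\<^sup>2 < B \<and> B \<le> 1 \<and> z\<^sup>2 \<le> B
      then ennreal ((poly p z)\<^sup>2 / sqrt (B - z\<^sup>2)) else 0)" for B z
  have F_meas [measurable]: "case_prod F \<in> borel_measurable (lborel \<Otimes>\<^sub>M lborel)"
    unfolding F_def by measurable
  have [measurable]: "F B \<in> borel_measurable borel" "(\<lambda>B. F B z) \<in> borel_measurable borel" for B z
    unfolding F_def by measurable
  have "ennreal (s\<^sup>2) * ennreal ((poly p y)\<^sup>2)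
      = (\<integral>\<^sup>+B. ennreal ((poly p y)\<^sup>2) * indicator {y\<^sup>2<..1} B \<partial>lborel)"
    using s y by (simp add: nn_integral_cmult mult.commute abs_square_le_1)
  also have "\<dots> \<le> (\<integral>\<^sup>+B. ennreal C * (\<integral>\<^sup>+z. F B z \<partial>lborel) \<partial>lborel)"
  proof (intro nn_integral_mono)
    fix B :: real
    show "ennreal ((poly p y)\<^sup>2) * indicator {y\<^sup>2<..1} B \<le> ennreal C * (\<integral>\<^sup>+z. F B z \<partial>lborel)"
    proof (cases "B \<in> {y\<^sup>2<..1}")
      case True
      then have B: "0 < B" "y\<^sup>2 \<le> B" using le_less_trans[OF zero_le_power2[of y]] by auto
      have "z\<^sup>2 \<le> B \<longleftrightarrow> z \<in> {- sqrt B..sqrt B}" for z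
        using real_sqrt_le_iff[of "z\<^sup>2" B] by (auto simp: abs_le_iff)
      then have "F B z = ennreal ((poly p z)\<^sup>2 / sqrt (B - z\<^sup>2)) * indicator {- sqrt B..sqrt B} z" for z
        using True by (auto simp: F_def indicator_def)
      then show ?thesis
        using True poly_christoffel_chebyshev_weight[OF n B] by (simp add: C_def)
    qed simp
  qed
  also have "\<dots> = ennreal C * (\<integral>\<^sup>+z. \<integral>\<^sup>+B. F B z \<partial>lborel \<partial>lborel)"
    by (subst lborel_pair.Fubini'[OF F_meas]) (simp add: nn_integral_cmult)
  also have "(\<integral>\<^sup>+z. \<integral>\<^sup>+B. F B z \<partial>lborel \<partial>lborel)
      \<le> (\<integral>\<^sup>+z. ennreal (2 * s) * (ennreal ((poly p z)\<^sup>2) * indicator {-1..1} z) \<partial>lborel)"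
  proof (intro nn_integral_mono)
    fix z :: real
    show "(\<integral>\<^sup>+B. F B z \<partial>lborel) \<le> ennreal (2 * s) * (ennreal ((poly p z)\<^sup>2) * indicator {-1..1} z)"
    proof (cases "z\<^sup>2 \<le> 1")
      case True
      define m where "m = max (y\<^sup>2) (z\<^sup>2)"
      have m: "z\<^sup>2 \<le> m" "m \<le> 1" "1 - m \<le> s\<^sup>2" using True y s
        by (auto simp: m_def abs_square_le_1 less_imp_le)
      have "(\<integral>\<^sup>+B. F B z \<partial>lborel) \<le> (\<integral>\<^sup>+B. ennreal ((poly p z)\<^sup>2) *
          (ennreal (1 / sqrt (B - z\<^sup>2)) * indicator {m..1} B) \<partial>lborel)"
        by (intro nn_integral_mono)
           (auto simp: F_def m_def ennreal_mult'[symmetric] split: split_indicator)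
      also have "\<dots> = ennreal ((poly p z)\<^sup>2) *
          (\<integral>\<^sup>+B. ennreal (1 / sqrt (B - z\<^sup>2)) * indicator {m..1} B \<partial>lborel)"
        by (intro nn_integral_cmult) measurable
      also have "\<dots> \<le> ennreal ((poly p z)\<^sup>2) * ennreal (2 * s)"
        using m(3) s
        by (intro mult_left_mono order_trans[OF nn_integral_inverse_sqrt_le[OF m(1,2)]] ennreal_leI)
           (auto intro: real_le_lsqrt)
      finally show ?thesis using True by (simp add: mult.commute abs_square_le_1 abs_le_iff)
    next
      case False
      then have "F B z = 0" for B by (auto simp: F_def)
      then show ?thesis by simp
    qed
  qed
  also have "\<dots> = ennreal (2 * s) * (\<integral>\<^sup>+z. ennreal ((poly p z)\<^sup>2) * indicator {-1..1} z \<partial>lborel)"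
    by (intro nn_integral_cmult) measurable
  finally have "ennreal (s\<^sup>2) * ennreal ((poly p y)\<^sup>2) \<le> ennreal C * (ennreal (2 * s) *
      (\<integral>\<^sup>+z. ennreal ((poly p z)\<^sup>2) * indicator {-1..1} z \<partial>lborel))"
    by (simp add: mult_left_mono)
  then have "ennreal (1 / s) * (ennreal (s\<^sup>2) * ennreal ((poly p y)\<^sup>2)) \<le> ennreal (1 / s) *
      (ennreal C * (ennreal (2 * s) *
      (\<integral>\<^sup>+z. ennreal ((poly p z)\<^sup>2) * indicator {-1..1} z \<partial>lborel)))"
    by (intro mult_left_mono) auto
  moreover have "ennreal (1 / s) * (ennreal (s\<^sup>2) * ennreal ((poly p y)\<^sup>2)) = ennreal (s * (poly p y)\<^sup>2)"
    using s(1) by (simp add: ennreal_mult'[symmetric] power2_eq_square)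
  moreover have "ennreal (1 / s) * (ennreal C * (ennreal (2 * s) * I))
      = ennreal (4 * (real n + 1) / pi) * I" for I
  proof -
    have "ennreal (1 / s) * ennreal C * ennreal (2 * s) = ennreal (4 * (real n + 1) / pi)"
      using s(1) by (simp add: ennreal_mult'[symmetric] C_def)
    then show ?thesis by (simp only: mult.assoc[symmetric])
  qed
  ultimately show ?thesis by (simp add: s_def)
qed

lemma poly_christoffel_interval:
  fixes p :: "real poly"
  assumes n: "degree p \<le> n" and y: "a < y" "y < b"
  shows "ennreal (sqrt ((y - a) * (b - y)) * (poly p y)\<^sup>2)
    \<le> ennreal (4 * (real n + 1) / pi) * (\<integral>\<^sup>+z. ennreal ((poly p z)\<^sup>2) * indicator {a..b} z \<partial>lborel)"
proof -
  define c r where "c = (a + b) / 2" and "r = (b - a) / 2"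
  define q where "q = p \<circ>\<^sub>p [:c, r:]"
  have r: "0 < r" using y by (simp add: r_def)
  have q: "poly q w = poly p (c + r * w)" for w by (simp add: q_def poly_pcompose mult.commute)
  have "degree q \<le> n" using degree_pcompose_le[of p "[:c, r:]"] r n by (simp add: q_def)
  moreover define w where "w = (y - c) / r"
  have w: "\<bar>w\<bar> < 1" using y by (auto simp: w_def r_def c_def abs_if field_simps)
  ultimately have "ennreal (sqrt (1 - w\<^sup>2) * (poly q w)\<^sup>2) \<le> ennreal (4 * (real n + 1) / pi) *
      (\<integral>\<^sup>+z. ennreal ((poly q z)\<^sup>2) * indicator {-1..1} z \<partial>lborel)"
    by (intro poly_christoffel_unit_interval)
  then have "ennreal r * ennreal (sqrt (1 - w\<^sup>2) * (poly q w)\<^sup>2) \<le> ennreal r *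
      (ennreal (4 * (real n + 1) / pi) * (\<integral>\<^sup>+z. ennreal ((poly q z)\<^sup>2) * indicator {-1..1} z \<partial>lborel))"
    by (intro mult_left_mono) auto
  also have "\<dots> = ennreal (4 * (real n + 1) / pi) *
      (\<bar>r\<bar> * (\<integral>\<^sup>+z. ennreal ((poly p (c + r * z))\<^sup>2) * indicator {a..b} (c + r * z) \<partial>lborel))"
  proof -
    have "c + r * z \<in> {a..b} \<longleftrightarrow> z \<in> {-1..1}" for z
    proof -
      have "a = c - r" "b = c + r" by (auto simp: c_def r_def field_simps)
      then have "c + r * z \<in> {a..b} \<longleftrightarrow> r * (-1) \<le> r * z \<and> r * z \<le> r * 1" by auto
      then show ?thesis using r unfolding mult_le_cancel_left by auto
    qed
    then show ?thesis using r by (simp add: q indicator_def mult.left_commute)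
  qed
  also have "\<dots> = ennreal (4 * (real n + 1) / pi) *
      (\<integral>\<^sup>+z. ennreal ((poly p z)\<^sup>2) * indicator {a..b} z \<partial>lborel)"
    using r by (subst nn_integral_real_affine[where c = r and t = c and f = "\<lambda>z. _ z * _ z"]) auto
  also have "ennreal r * ennreal (sqrt (1 - w\<^sup>2) * (poly q w)\<^sup>2)
      = ennreal (r * sqrt (1 - w\<^sup>2) * (poly p y)\<^sup>2)"
    using r by (simp add: ennreal_mult'[symmetric] mult.assoc q w_def)
  also have "r * sqrt (1 - w\<^sup>2) = sqrt (r\<^sup>2 * (1 - w\<^sup>2))"
    using r by (simp add: real_sqrt_mult)
  also have "r\<^sup>2 * (1 - w\<^sup>2) = (y - a) * (b - y)"
  proof -
    have "r\<^sup>2 * (1 - w\<^sup>2) = r\<^sup>2 - (y - c)\<^sup>2" using r by (simp add: w_def power_divide field_simps)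
    also have "\<dots> = (y - a) * (b - y)"
      unfolding r_def c_def power2_eq_square by (simp add: field_simps)
    finally show ?thesis .
  qed
  finally show ?thesis .
qed

section \<open>Integration in orthonormal coordinates of the plane\<close>

lemma Basis_real2: "Basis = {axis 1 1, axis 2 1 :: real^2}"
  by (auto simp: Basis_vec_def UNIV_2)

text \<open>A box is not mapped to a box, so the measure of its preimage is computed with the
  invariance of Lebesgue measure under orthogonal images.\<close>

lemma distr_lborel_orthogonal:
  fixes R :: "real^2 \<Rightarrow> real^2"
  assumes R: "orthogonal_transformation R"
  shows "distr lborel borel R = lborel"
proof (rule lborel_eqI[symmetric])
  fix l u :: "real^2"
  assume lu: "\<And>b. b \<in> Basis \<Longrightarrow> l \<bullet> b \<le> u \<bullet> b"
  have R_meas [measurable]: "R \<in> borel_measurable borel"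
    using orthogonal_transformation_linear[OF R]
    by (intro borel_measurable_continuous_onI linear_continuous_on linear_conv_bounded_linear[THEN iffD1])
  have "emeasure (distr lborel borel R) (box l u) = emeasure lborel (R -` box l u)"
    by (simp add: emeasure_distr)
  also have "\<dots> = emeasure lebesgue (R -` box l u)"
    using measurable_sets_borel[OF R_meas, of "box l u"] by simp
  also have "R -` box l u = inv R ` box l u"
    using orthogonal_transformation_bij[OF R] by (simp add: bij_vimage_eq_inv_image)
  also have "emeasure lebesgue (inv R ` box l u) = emeasure lebesgue (box l u)"
    using orthogonal_transformation_inv[OF R]
    by (simp add: emeasure_eq_measure2 measurable_orthogonal_image measure_orthogonal_image)
  also have "\<dots> = (\<Prod>b\<in>Basis. (u - l) \<bullet> b)"
    using lu by (simp add: emeasure_lborel_box)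
  finally show "emeasure (distr lborel borel R) (box l u) = (\<Prod>b\<in>Basis. (u - l) \<bullet> b)" .
qed simp

lemma distr_lborel_vector:
  "distr (lborel :: (real \<times> real) measure) borel (\<lambda>(s, t). vector [s, t] :: real^2) = lborel"
proof (rule lborel_eqI[symmetric])
  fix l u :: "real^2"
  assume lu: "\<And>b. b \<in> Basis \<Longrightarrow> l \<bullet> b \<le> u \<bullet> b"
  have le: "l $ 1 \<le> u $ 1" "l $ 2 \<le> u $ 2"
    using lu[of "axis 1 1"] lu[of "axis 2 1"] by (auto simp: Basis_real2 inner_axis)
  let ?h = "\<lambda>(s, t). vector [s, t] :: real^2"
  have "?h = (\<lambda>z. fst z *\<^sub>R axis 1 1 + snd z *\<^sub>R axis 2 1)"
    by (auto simp: vec_eq_iff forall_2 axis_def)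
  then have [measurable]: "?h \<in> borel_measurable borel"
    by (auto intro!: borel_measurable_continuous_onI continuous_intros)
  have box_Pair: "box (a, c) (b, d) = box a b \<times> box c d" for a b c d :: real
    by (force simp: box_def Basis_prod_def)
  have "emeasure (distr lborel borel ?h) (box l u) = emeasure lborel (?h -` box l u)"
    by (simp add: emeasure_distr)
  also have "?h -` box l u = box (l $ 1, l $ 2) (u $ 1, u $ 2)"
    by (auto simp: mem_box_cart forall_2 box_Pair)
  also have "emeasure lborel \<dots> = ennreal ((u $ 1 - l $ 1) * (u $ 2 - l $ 2))"
    using le by (simp add: lborel_prod[symmetric] box_Pair lborel.emeasure_pair_measure_Times ennreal_mult)
  also have "\<dots> = (\<Prod>b\<in>Basis. (u - l) \<bullet> b)"
    by (simp add: Basis_real2 inner_axis axis_eq_axis)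
  finally show "emeasure (distr lborel borel ?h) (box l u) = (\<Prod>b\<in>Basis. (u - l) \<bullet> b)" .
qed simp

lemma nn_integral_orthonormal_coordinates:
  fixes u v z :: "real^2"
  assumes uv: "norm u = 1" "norm v = 1" "u \<bullet> v = 0"
    and F [measurable]: "F \<in> borel_measurable borel"
  shows "(\<integral>\<^sup>+y. F y \<partial>lborel) = (\<integral>\<^sup>+s. \<integral>\<^sup>+t. F (z + t *\<^sub>R u + s *\<^sub>R v) \<partial>lborel \<partial>lborel)"
proof -
  define R :: "real^2 \<Rightarrow> real^2" where "R y = y $ 2 *\<^sub>R u + y $ 1 *\<^sub>R v" for y
  have "linear R" by (auto simp: R_def linear_iff algebra_simps)
  moreover have "R y \<bullet> R y' = y \<bullet> y'" for y y'
  proof -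
    have "R y \<bullet> R y' = y $ 1 * y' $ 1 + y $ 2 * y' $ 2"
      using uv by (simp add: R_def inner_add inner_commute[of v u] norm_eq_1)
    then show ?thesis by (simp add: inner_vec_def sum_2)
  qed
  ultimately have R: "orthogonal_transformation R" by (auto simp: orthogonal_transformation_def)
  have R_meas [measurable]: "R \<in> borel_measurable borel"
    unfolding R_def by (intro borel_measurable_continuous_onI continuous_intros)
  let ?h = "\<lambda>(s, t). vector [s, t] :: real^2"
  have "?h = (\<lambda>z. fst z *\<^sub>R axis 1 1 + snd z *\<^sub>R axis 2 1)"
    by (auto simp: vec_eq_iff forall_2 axis_def)
  then have h [measurable]: "?h \<in> borel_measurable borel"
    by (auto intro!: borel_measurable_continuous_onI continuous_intros)
  have "(\<integral>\<^sup>+y. F y \<partial>lborel) = (\<integral>\<^sup>+y. F (z + y) \<partial>lborel)"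
    using lborel_distr_plus[of z] nn_integral_distr[of "(+) z" lborel borel F] by simp
  also have "\<dots> = (\<integral>\<^sup>+y. F (z + R y) \<partial>lborel)"
    using nn_integral_distr[of R lborel borel "\<lambda>y. F (z + y)"] by (simp add: distr_lborel_orthogonal[OF R])
  also have "\<dots> = (\<integral>\<^sup>+p. F (z + R (?h p)) \<partial>lborel)"
    using nn_integral_distr[of ?h lborel borel "\<lambda>y. F (z + R y)"] by (simp add: distr_lborel_vector)
  also have "\<dots> = (\<integral>\<^sup>+p. F (z + R (?h p)) \<partial>(lborel \<Otimes>\<^sub>M lborel))"
    by (simp add: lborel_prod)
  also have "\<dots> = (\<integral>\<^sup>+s. \<integral>\<^sup>+t. F (z + R (?h (s, t))) \<partial>lborel \<partial>lborel)"
    using h by (intro lborel.nn_integral_fst[symmetric]) (simp add: lborel_prod)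
  finally show ?thesis by (simp add: R_def add.assoc)
qed

section \<open>Polynomials on the plane and orthonormal bases\<close>

text \<open>Restriction to a curve with polynomial coordinates is how the one-dimensional inequality reaches \<open>f\<close>:
  it is used for lines (\<open>d = 1\<close>) and for a parabola (\<open>d = 2\<close>).\<close>

lemma poly_fun_on_curve:
  assumes f: "f \<in> poly_fun n" and A: "degree A \<le> d" and B: "degree B \<le> d"
    and g: "\<And>r. g r $ 1 = poly A r" "\<And>r. g r $ 2 = poly B r"
  obtains p where "degree p \<le> d * n" "\<And>r. f (g r) = poly p r"
proof -
  obtain c where c: "\<And>y. f y = (\<Sum>i\<le>n. \<Sum>j\<le>n - i. c i j * (y $ 1) ^ i * (y $ 2) ^ j)"
    using f unfolding poly_fun_def by auto
  define p where "p = (\<Sum>i\<le>n. \<Sum>j\<le>n - i. smult (c i j) (A ^ i * B ^ j))"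
  have "degree (smult (c i j) (A ^ i * B ^ j)) \<le> d * n" if "i \<le> n" "j \<le> n - i" for i j
  proof -
    have "degree (A ^ i * B ^ j) \<le> degree A * i + degree B * j"
      by (intro order_trans[OF degree_mult_le] add_mono degree_power_le)
    also have "\<dots> \<le> d * i + d * j" using A B by (intro add_mono mult_right_mono) auto
    also have "\<dots> = d * (i + j)" by (simp add: algebra_simps)
    also have "\<dots> \<le> d * n" using that by (intro mult_left_mono) auto
    finally show ?thesis using degree_smult_le order_trans by blast
  qed
  then have "degree p \<le> d * n"
    unfolding p_def by (intro degree_sum_le) auto
  moreover have "f (g r) = poly p r" for r
    by (simp add: c p_def poly_sum g mult.assoc)
  ultimately show thesis by (rule that)
qed

lemma poly_fun_add:
  assumes "f \<in> poly_fun n" "g \<in> poly_fun n"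
  shows "(\<lambda>y. f y + g y) \<in> poly_fun n"
proof -
  obtain c d where "\<And>y. f y = (\<Sum>i\<le>n. \<Sum>j\<le>n - i. c i j * (y $ 1) ^ i * (y $ 2) ^ j)"
    "\<And>y. g y = (\<Sum>i\<le>n. \<Sum>j\<le>n - i. d i j * (y $ 1) ^ i * (y $ 2) ^ j)"
    using assms unfolding poly_fun_def by auto
  then have "f y + g y = (\<Sum>i\<le>n. \<Sum>j\<le>n - i. (c i j + d i j) * (y $ 1) ^ i * (y $ 2) ^ j)" for y
    by (simp add: distrib_right sum.distrib)
  then show ?thesis unfolding poly_fun_def by (intro CollectI exI[of _ "\<lambda>i j. c i j + d i j"]) simp
qed

lemma poly_fun_cmult:
  assumes "f \<in> poly_fun n"
  shows "(\<lambda>y. a * f y) \<in> poly_fun n"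
proof -
  obtain c where "\<And>y. f y = (\<Sum>i\<le>n. \<Sum>j\<le>n - i. c i j * (y $ 1) ^ i * (y $ 2) ^ j)"
    using assms unfolding poly_fun_def by auto
  then have "a * f y = (\<Sum>i\<le>n. \<Sum>j\<le>n - i. (a * c i j) * (y $ 1) ^ i * (y $ 2) ^ j)" for y
    by (simp add: sum_distrib_left mult.assoc)
  then show ?thesis unfolding poly_fun_def by (intro CollectI exI[of _ "\<lambda>i j. a * c i j"]) simp
qed

lemma poly_fun_sum:
  assumes "finite B" "\<And>b. b \<in> B \<Longrightarrow> f b \<in> poly_fun n"
  shows "(\<lambda>y. \<Sum>b\<in>B. f b y) \<in> poly_fun n"
  using assms
proof (induction B)
  case empty
  then show ?case unfolding poly_fun_def by (intro CollectI exI[of _ "\<lambda>_ _. 0"]) simp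
qed (auto intro: poly_fun_add)

lemma poly_fun_monomial:
  assumes "i \<le> n" "j \<le> n - i"
  shows "(\<lambda>y. (y $ 1) ^ i * (y $ 2) ^ j) \<in> poly_fun n"
proof -
  have "(y $ 1) ^ i * (y $ 2) ^ j
      = (\<Sum>i'\<le>n. \<Sum>j'\<le>n - i'. of_bool (i' = i \<and> j' = j) * (y $ 1) ^ i' * (y $ 2) ^ j')" for y :: "real^2"
  proof -
    have "(\<Sum>i'\<le>n. \<Sum>j'\<le>n - i'. of_bool (i' = i \<and> j' = j) * (y $ 1) ^ i' * (y $ 2) ^ j')
        = (\<Sum>i'\<le>n. if i' = i then (\<Sum>j'\<le>n - i. if j' = j then (y $ 1) ^ i * (y $ 2) ^ j else 0) else 0)"
    proof (rule sum.cong[OF refl])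
      fix i'
      show "(\<Sum>j'\<le>n - i'. of_bool (i' = i \<and> j' = j) * (y $ 1) ^ i' * (y $ 2) ^ j')
        = (if i' = i then (\<Sum>j'\<le>n - i. if j' = j then (y $ 1) ^ i * (y $ 2) ^ j else 0) else 0)"
      proof (cases "i' = i")
        case True
        show ?thesis unfolding True if_P[OF refl] by (rule sum.cong) auto
      qed simp
    qed
    also have "\<dots> = (y $ 1) ^ i * (y $ 2) ^ j"
      using assms by (simp only: sum.delta finite_atMost atMost_iff if_True)
    finally show ?thesis by simp
  qed
  then show ?thesis
    unfolding poly_fun_def
    by (intro CollectI exI[of _ "\<lambda>i' j'. of_bool (i' = i \<and> j' = j)"]) blast
qed

text \<open>Definiteness of the inner product. The square of \<open>f\<close> is continuous with integral zero, so \<open>f\<close>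
  vanishes on a box inside \<open>D\<close>; on the line from a point of that box to any \<open>y\<close> it is a polynomial in
  one variable with infinitely many zeros.\<close>

lemma poly_fun_eq_0:
  assumes D: "compact D" "interior D \<noteq> {}" and f: "f \<in> poly_fun n" and z: "inner_on D f f = 0"
  shows "f y = 0"
proof -
  obtain e where e: "e \<in> interior D" using D(2) by blast
  then obtain a b where ab: "box a b \<noteq> {}" "cbox a b \<subseteq> interior D"
    using open_contains_cbox[OF open_interior e] by (metis empty_iff)
  then have sub: "cbox a b \<subseteq> D" using interior_subset by blast
  have int: "set_integrable lborel D (\<lambda>y. f y * f y)"
    by (rule poly_fun_prod_integrable[OF D(1) f f])
  have "integral (cbox a b) (\<lambda>y. f y * f y) \<le> integral D (\<lambda>y. f y * f y)"
    using set_borel_integral_eq_integral(1)[OF int] sub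
    by (intro integral_subset_le integrable_continuous continuous_on_mult poly_fun_continuous[OF f]) auto
  also have "\<dots> = 0"
    using set_borel_integral_eq_integral(2)[OF int] z by (simp add: inner_on_def)
  finally have "integral (cbox a b) (\<lambda>y. f y * f y) = 0"
    by (intro antisym integral_nonneg integrable_continuous continuous_on_mult poly_fun_continuous[OF f]) auto
  then have "((\<lambda>y. f y * f y) has_integral 0) (cbox a b)"
    by (metis has_integral_integral integrable_continuous continuous_on_mult poly_fun_continuous[OF f])
  then have zero: "f w = 0" if "w \<in> cbox a b" for w
    using has_integral_0_cbox_imp_0[of a b "\<lambda>y. f y * f y" w] ab(1) that
      continuous_on_mult[OF poly_fun_continuous[OF f] poly_fun_continuous[OF f]] by auto
  obtain w where w: "w \<in> box a b" using ab(1) by blast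
  obtain p where p: "\<And>r. f (w + r *\<^sub>R (y - w)) = poly p r"
    by (rule poly_fun_on_curve[OF f, of "[:w $ 1, y $ 1 - w $ 1:]" 1 "[:w $ 2, y $ 2 - w $ 2:]"
          "\<lambda>r. w + r *\<^sub>R (y - w)"]) auto
  have "open ((\<lambda>r. w + r *\<^sub>R (y - w)) -` box a b)"
    by (intro open_vimage open_box continuous_intros)
  moreover have "0 \<in> (\<lambda>r. w + r *\<^sub>R (y - w)) -` box a b"
    using w by simp
  ultimately have "infinite ((\<lambda>r. w + r *\<^sub>R (y - w)) -` box a b)"
    using finite_imp_not_open by blast
  moreover have "(\<lambda>r. w + r *\<^sub>R (y - w)) -` box a b \<subseteq> {r. poly p r = 0}"
    using zero box_subset_cbox[of a b] by (auto simp flip: p)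
  ultimately have "p = 0" using poly_roots_finite finite_subset by blast
  then show ?thesis using p[of 1] by simp
qed

lemma inner_on_commute: "inner_on D f g = inner_on D g f"
  by (simp add: inner_on_def mult.commute)

lemma inner_on_self_nonneg: "0 \<le> inner_on D f f"
  by (auto simp: inner_on_def set_lebesgue_integral_def intro!: integral_nonneg_AE)

lemma inner_on_add_left:
  assumes "compact D" "f \<in> poly_fun n" "g \<in> poly_fun n" "h \<in> poly_fun n"
  shows "inner_on D (\<lambda>y. f y + g y) h = inner_on D f h + inner_on D g h"
  using poly_fun_prod_integrable[OF assms(1,2,4)] poly_fun_prod_integrable[OF assms(1,3,4)]
  by (simp add: inner_on_def distrib_right set_integral_add(2))

lemma inner_on_cmult_left: "inner_on D (\<lambda>y. a * f y) h = a * inner_on D f h"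
  by (simp add: inner_on_def mult.assoc)

lemma inner_on_sum_left:
  assumes D: "compact D" and g: "g \<in> poly_fun n"
    and B: "finite B" "\<And>b. b \<in> B \<Longrightarrow> f b \<in> poly_fun n"
  shows "inner_on D (\<lambda>y. \<Sum>b\<in>B. a b * f b y) g = (\<Sum>b\<in>B. a b * inner_on D (f b) g)"
  using B
proof (induction B)
  case empty
  then show ?case by (simp add: inner_on_def)
next
  case (insert b B)
  then show ?case
    by (simp add: inner_on_add_left[OF D _ _ g] poly_fun_cmult poly_fun_sum inner_on_cmult_left)
qed

text \<open>Gram--Schmidt orthogonalisation, one function at a time: the residual \<open>r\<close> of the new function \<open>g\<close>
  is either the zero function, and nothing is added, or it is normalised and added to the family.\<close>

lemma exists_orthonormal_spanning:
  assumes D: "compact D" "interior D \<noteq> {}" and M: "finite M" "M \<subseteq> poly_fun n"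
  shows "\<exists>B. finite B \<and> B \<subseteq> poly_fun n
     \<and> (\<forall>\<phi>\<in>B. \<forall>\<psi>\<in>B. inner_on D \<phi> \<psi> = (if \<phi> = \<psi> then 1 else 0))
     \<and> (\<forall>f\<in>M. \<exists>a. \<forall>y. f y = (\<Sum>\<phi>\<in>B. a \<phi> * \<phi> y))"
  using M
proof (induction M)
  case empty
  then show ?case by (intro exI[of _ "{}"]) auto
next
  case (insert g M)
  from insert.prems have "M \<subseteq> poly_fun n" by simp
  from insert.IH[OF this] obtain B where B: "finite B" "B \<subseteq> poly_fun n"
    "\<forall>\<phi>\<in>B. \<forall>\<psi>\<in>B. inner_on D \<phi> \<psi> = (if \<phi> = \<psi> then 1 else 0)"
    and span: "\<forall>f\<in>M. \<exists>a. \<forall>y. f y = (\<Sum>\<phi>\<in>B. a \<phi> * \<phi> y)"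
    by blast
  have g: "g \<in> poly_fun n" using insert.prems by simp
  define P where "P y = (\<Sum>\<phi>\<in>B. - inner_on D g \<phi> * \<phi> y)" for y
  have P: "P \<in> poly_fun n"
    unfolding P_def using B by (intro poly_fun_sum poly_fun_cmult) auto
  define r where "r y = g y + P y" for y
  have r: "r \<in> poly_fun n" unfolding r_def by (intro poly_fun_add g P)
  have r_orth: "inner_on D r \<psi> = 0" if "\<psi> \<in> B" for \<psi>
  proof -
    have "inner_on D P \<psi> = (\<Sum>\<phi>\<in>B. - inner_on D g \<phi> * inner_on D \<phi> \<psi>)"
      unfolding P_def using B(1,2) that by (intro inner_on_sum_left[OF D(1)]) auto
    also have "\<dots> = (\<Sum>\<phi>\<in>B. if \<phi> = \<psi> then - inner_on D g \<psi> else 0)"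
      using that by (intro sum.cong) (auto simp: B(3))
    finally have "inner_on D P \<psi> = - inner_on D g \<psi>" using B(1) that by simp
    then show ?thesis
      unfolding r_def using B(2) that by (subst inner_on_add_left[OF D(1) g P]) auto
  qed
  have g_eq: "g y = r y + (\<Sum>\<phi>\<in>B. inner_on D g \<phi> * \<phi> y)" for y
    by (simp add: r_def P_def sum_negf)
  show ?case
  proof (cases "inner_on D r r = 0")
    case True
    then have "r y = 0" for y by (rule poly_fun_eq_0[OF D r])
    then have "\<exists>a. \<forall>y. g y = (\<Sum>\<phi>\<in>B. a \<phi> * \<phi> y)"
      using g_eq by (intro exI[of _ "inner_on D g"]) simp
    then show ?thesis using B span by (intro exI[of _ B]) auto
  next
    case False
    define \<nu> where "\<nu> = sqrt (inner_on D r r)"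
    have \<nu>: "0 < \<nu>" "inner_on D r r = \<nu> * \<nu>"
      using False inner_on_self_nonneg[of D r] by (auto simp: \<nu>_def)
    define e where "e y = inverse \<nu> * r y" for y
    have e: "e \<in> poly_fun n" unfolding e_def by (intro poly_fun_cmult r)
    have e_left: "inner_on D e h = inverse \<nu> * inner_on D r h" for h
      unfolding e_def by (rule inner_on_cmult_left)
    have ee: "inner_on D e e = 1"
      using \<nu> by (simp add: e_left inner_on_commute[of D r e] field_simps)
    have e_orth: "inner_on D e \<psi> = 0" "inner_on D \<psi> e = 0" if "\<psi> \<in> B" for \<psi>
      using r_orth[OF that] by (simp_all add: e_left inner_on_commute[of D \<psi> e])
    have e_new: "e \<notin> B" using ee e_orth by force
    have "\<exists>a. \<forall>y. f y = (\<Sum>\<phi>\<in>insert e B. a \<phi> * \<phi> y)" if "f \<in> insert g M" for f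
    proof (cases "f = g")
      case True
      have "g y = (\<Sum>\<phi>\<in>insert e B. (if \<phi> = e then \<nu> else inner_on D g \<phi>) * \<phi> y)" for y
      proof -
        have "(\<Sum>\<phi>\<in>B. (if \<phi> = e then \<nu> else inner_on D g \<phi>) * \<phi> y)
            = (\<Sum>\<phi>\<in>B. inner_on D g \<phi> * \<phi> y)"
          using e_new by (intro sum.cong) auto
        moreover have "\<nu> * e y = r y" using \<nu>(1) unfolding e_def by simp
        ultimately show ?thesis
          unfolding sum.insert[OF B(1) e_new] g_eq[of y] by simp
      qed
      then show ?thesis
        unfolding True by (intro exI[of _ "\<lambda>\<phi>. if \<phi> = e then \<nu> else inner_on D g \<phi>"] allI)
    next
      case False
      with that have "f \<in> M" by simp
      from bspec[OF span this] obtain a where "\<forall>y. f y = (\<Sum>\<phi>\<in>B. a \<phi> * \<phi> y)" ..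
      then have a: "\<And>y. f y = (\<Sum>\<phi>\<in>B. a \<phi> * \<phi> y)" by (rule spec)
      have "f y = (\<Sum>\<phi>\<in>insert e B. (if \<phi> = e then 0 else a \<phi>) * \<phi> y)" for y
      proof -
        have "(\<Sum>\<phi>\<in>B. (if \<phi> = e then 0 else a \<phi>) * \<phi> y) = (\<Sum>\<phi>\<in>B. a \<phi> * \<phi> y)"
          using e_new by (intro sum.cong) auto
        then show ?thesis unfolding sum.insert[OF B(1) e_new] a by simp
      qed
      then show ?thesis by (intro exI[of _ "\<lambda>\<phi>. if \<phi> = e then 0 else a \<phi>"] allI)
    qed
    moreover have "inner_on D \<phi> \<psi> = (if \<phi> = \<psi> then 1 else 0)"
      if "\<phi> \<in> insert e B" "\<psi> \<in> insert e B" for \<phi> \<psi>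
    proof (cases "\<phi> = e"; cases "\<psi> = e")
      assume "\<phi> \<noteq> e" "\<psi> \<noteq> e"
      then show ?thesis using that B(3) by simp
    qed (use that ee e_orth e_new in auto)
    ultimately show ?thesis
      using B(1,2) e by (intro exI[of _ "insert e B"] conjI ballI) simp_all
  qed
qed

text \<open>Without this existence statement nothing would be known about the basis chosen in
  \<^const>\<open>christoffel\<close>. The monomials span \<^term>\<open>poly_fun n\<close>, so it suffices to orthonormalise them.\<close>

lemma exists_onb:
  assumes D: "compact D" "interior D \<noteq> {}"
  shows "\<exists>B. is_onb n D B"
proof -
  define m :: "nat \<Rightarrow> nat \<Rightarrow> real^2 \<Rightarrow> real" where "m i j y = (y $ 1) ^ i * (y $ 2) ^ j" for i j y
  define I where "I = Sigma {..n} (\<lambda>i. {..n - i})"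
  have "(\<lambda>(i, j). m i j) ` I \<subseteq> poly_fun n"
    using poly_fun_monomial unfolding m_def[abs_def] by (auto simp: I_def)
  moreover have "finite ((\<lambda>(i, j). m i j) ` I)" by (simp add: I_def)
  ultimately obtain B where B: "finite B" "B \<subseteq> poly_fun n"
    "\<forall>\<phi>\<in>B. \<forall>\<psi>\<in>B. inner_on D \<phi> \<psi> = (if \<phi> = \<psi> then 1 else 0)"
    and span: "\<forall>f\<in>(\<lambda>(i, j). m i j) ` I. \<exists>a. \<forall>y. f y = (\<Sum>\<phi>\<in>B. a \<phi> * \<phi> y)"
    using exists_orthonormal_spanning[OF D, of "(\<lambda>(i, j). m i j) ` I" n] by blast
  have "\<exists>a. \<forall>y. m i j y = (\<Sum>\<phi>\<in>B. a \<phi> * \<phi> y)" if "i \<le> n" "j \<le> n - i" for i j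
    using that by (intro span[rule_format]) (auto simp: I_def)
  then obtain a where a: "\<And>i j y. i \<le> n \<Longrightarrow> j \<le> n - i \<Longrightarrow> m i j y = (\<Sum>\<phi>\<in>B. a i j \<phi> * \<phi> y)"
    by metis
  have "\<exists>b. \<forall>y. f y = (\<Sum>\<phi>\<in>B. b \<phi> * \<phi> y)" if f: "f \<in> poly_fun n" for f
  proof -
    obtain c where c: "\<And>y. f y = (\<Sum>i\<le>n. \<Sum>j\<le>n - i. c i j * (y $ 1) ^ i * (y $ 2) ^ j)"
      using f unfolding poly_fun_def by auto
    have "f y = (\<Sum>\<phi>\<in>B. (\<Sum>(i, j)\<in>I. c i j * a i j \<phi>) * \<phi> y)" for y
    proof -
      have "f y = (\<Sum>(i, j)\<in>I. c i j * m i j y)"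
        by (simp add: c I_def m_def sum.Sigma mult.assoc)
      also have "\<dots> = (\<Sum>(i, j)\<in>I. \<Sum>\<phi>\<in>B. c i j * a i j \<phi> * \<phi> y)"
        by (intro sum.cong) (auto simp: I_def a sum_distrib_left mult.assoc)
      also have "\<dots> = (\<Sum>\<phi>\<in>B. \<Sum>(i, j)\<in>I. c i j * a i j \<phi> * \<phi> y)"
        unfolding case_prod_beta by (rule sum.swap)
      finally show ?thesis by (simp add: sum_distrib_right case_prod_beta)
    qed
    then show ?thesis by (intro exI allI)
  qed
  then have "is_onb n D B" using B by (simp add: is_onb_def)
  then show ?thesis ..
qed

lemma christoffel_nonneg: "0 \<le> christoffel n D x"
  by (simp add: christoffel_def sum_nonneg)

text \<open>The extremal polynomial is the reproducing kernel \<open>f = \<Sum> \<phi>(x) \<phi>\<close>: both \<open>f(x)\<close> and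
  \<open>\<integral>\<^sub>D f\<^sup>2\<close> are equal to the sum \<open>K\<close> whose inverse is the Christoffel function.\<close>

lemma le_christoffel:
  assumes D: "compact D" "interior D \<noteq> {}"
    and C: "\<And>f. f \<in> poly_fun n \<Longrightarrow> C * (f x)\<^sup>2 \<le> inner_on D f f"
  shows "C \<le> christoffel n D x"
proof -
  obtain B where B: "is_onb n D B" using exists_onb[OF D] by blast
  have fin: "finite B" and Bn: "\<And>\<phi>. \<phi> \<in> B \<Longrightarrow> \<phi> \<in> poly_fun n"
    using B by (auto simp: is_onb_def)
  define K where "K = (\<Sum>\<phi>\<in>B. (\<phi> x)\<^sup>2)"
  \<comment> \<open>Otherwise all basis functions, and hence all polynomials, would vanish at \<open>x\<close>.\<close>
  have "K \<noteq> 0"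
  proof
    assume "K = 0"
    then have "\<phi> x = 0" if "\<phi> \<in> B" for \<phi>
      using that fin by (auto simp: K_def sum_nonneg_eq_0_iff)
    then have "(\<Sum>\<phi>\<in>B. inner_on D (\<lambda>y. 1) \<phi> * \<phi> x) = 0" by (intro sum.neutral) auto
    moreover have "(\<lambda>y. 1) \<in> poly_fun n" using poly_fun_monomial[of 0 n 0] by simp
    ultimately show False using onb_expansion[OF D(1) B, of "\<lambda>y. 1" x] by simp
  qed
  then have K: "0 < K" unfolding K_def by (simp add: sum_nonneg less_le)
  define f where "f y = (\<Sum>\<phi>\<in>B. \<phi> x * \<phi> y)" for y
  have f: "f \<in> poly_fun n" unfolding f_def by (intro poly_fun_sum poly_fun_cmult fin Bn)
  have coeff: "inner_on D f \<psi> = \<psi> x" if "\<psi> \<in> B" for \<psi>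
  proof -
    have "inner_on D f \<psi> = (\<Sum>\<phi>\<in>B. \<phi> x * inner_on D \<phi> \<psi>)"
      unfolding f_def by (rule inner_on_sum_left[OF D(1) Bn[OF that] fin Bn])
    also have "\<dots> = (\<Sum>\<phi>\<in>B. if \<phi> = \<psi> then \<psi> x else 0)"
      using B that by (intro sum.cong) (auto simp: is_onb_def)
    finally show ?thesis using fin that by simp
  qed
  have "inner_on D f f = (\<Sum>\<phi>\<in>B. \<phi> x * inner_on D \<phi> f)"
    by (subst f_def[abs_def]) (rule inner_on_sum_left[OF D(1) f fin Bn])
  also have "\<dots> = K"
    by (simp add: K_def inner_on_commute[of D _ f] coeff power2_eq_square)
  finally have "C * (f x)\<^sup>2 \<le> K" using C[OF f] by simp
  moreover have "f x = K" by (simp add: f_def K_def power2_eq_square)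
  ultimately have "C * K * K \<le> 1 * K" by (simp add: power2_eq_square mult.assoc)
  then have "C * K \<le> 1" using K by simp
  then have "C \<le> inverse K" using K by (simp add: field_simps)
  then show ?thesis using christoffel_eq[OF D(1) B] by (simp add: K_def)
qed

section \<open>Polynomials on a piece of a parabola\<close>

lemma nn_integral_square_eq_inner_on:
  assumes "compact D" "f \<in> poly_fun n"
  shows "(\<integral>\<^sup>+y. ennreal ((f y)\<^sup>2) * indicator D y \<partial>lborel) = ennreal (inner_on D f f)"
proof -
  have "(\<integral>\<^sup>+y. ennreal ((f y)\<^sup>2) * indicator D y \<partial>lborel)
      = (\<integral>\<^sup>+y. ennreal (indicator D y *\<^sub>R (f y * f y)) \<partial>lborel)"
    by (intro nn_integral_cong) (auto simp: power2_eq_square split: split_indicator)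
  also have "\<dots> = ennreal (inner_on D f f)"
    using poly_fun_prod_integrable[OF assms assms(2)]
    unfolding inner_on_def set_lebesgue_integral_def set_integrable_def
    by (intro nn_integral_eq_integral) auto
  finally show ?thesis .
qed

text \<open>In the coordinates \<open>(s, t)\<close> of \<open>g s t\<close> the point \<open>x\<close> is \<open>(0, \<delta>)\<close>. The curve
  \<open>t = \<delta> + s\<^sup>2/M\<^sup>2\<close> is a translate of the bounding parabola \<open>\<bar>s\<bar> = M \<surd>t\<close>, so its points are
  all at distance \<open>\<delta>\<close> from that parabola in the \<open>t\<close>-direction. The half of this gap next to the curve has
  \<open>t \<ge> \<delta>/2\<close> and is available at every \<open>s\<close>, whence the same factor \<open>W\<close> on all segments.\<close>

lemma parabolic_christoffel_bound:
  fixes u v x :: "real^2"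
  assumes D: "compact D" and uv: "norm u = 1" "norm v = 1" "u \<bullet> v = 0"
    and n: "n \<ge> 1" and M: "0 < M" and \<delta>: "0 < \<delta>" "\<delta> < \<beta> / 2"
    and sub: "\<And>s t. \<delta> / 2 \<le> t \<Longrightarrow> t \<le> \<beta> \<Longrightarrow> \<bar>s\<bar> \<le> M * sqrt t \<Longrightarrow>
      x + (\<delta> - t) *\<^sub>R u + s *\<^sub>R v \<in> D"
    and f: "f \<in> poly_fun n"
  shows "M * \<beta> * sqrt \<delta> / (100 * (real n)\<^sup>2) * (f x)\<^sup>2 \<le> inner_on D f f"
proof -
  have \<beta>: "0 < \<beta>" using \<delta> by simp
  \<comment> \<open>For \<open>\<bar>s\<bar> \<le> S\<close> the parabola rises by at most \<open>\<beta>/4\<close>; with \<open>\<delta>/2 < \<beta>/4\<close> and segments of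
      length \<open>\<beta>/2\<close> the parameter \<open>t\<close> does not exceed \<open>\<beta>\<close>.\<close>
  define S where "S = M * sqrt \<beta> / 2"
  define W where "W = sqrt (\<delta> * \<beta> / 8)"
  define g where "g s t = x + (\<delta> - t) *\<^sub>R u + s *\<^sub>R v" for s t
  define q where "q s = f (g s (\<delta> + s\<^sup>2 / M\<^sup>2))" for s
  define F where "F y = ennreal ((f y)\<^sup>2) * indicator D y" for y
  define C1 where "C1 = 4 * (real (2 * n) + 1) / pi"
  define C2 where "C2 = 4 * (real n + 1) / pi"
  have C: "0 \<le> C1" "0 \<le> C2" by (simp_all add: C1_def C2_def)
  have S: "0 < S" using M \<beta> by (simp add: S_def)
  have F [measurable]: "F \<in> borel_measurable borel"
  proof -
    have [measurable]: "f \<in> borel_measurable borel" "D \<in> sets borel"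
      using D by (auto intro: borel_measurable_continuous_onI poly_fun_continuous[OF f] borel_compact)
    show ?thesis unfolding F_def by measurable
  qed

  \<comment> \<open>The inequality along the parabola, at the midpoint \<open>s = 0\<close> of \<open>[-S, S]\<close>.\<close>
  obtain Q where Q: "degree Q \<le> 2 * n" "\<And>s. q s = poly Q s"
    unfolding q_def
    by (rule poly_fun_on_curve[OF f, of "[:x $ 1, v $ 1, - u $ 1 / M\<^sup>2:]" 2
          "[:x $ 2, v $ 2, - u $ 2 / M\<^sup>2:]" "\<lambda>s. g s (\<delta> + s\<^sup>2 / M\<^sup>2)"])
       (auto simp: g_def power2_eq_square algebra_simps)
  have "ennreal (sqrt ((0 - (- S)) * (S - 0)) * (poly Q 0)\<^sup>2)
      \<le> ennreal C1 * (\<integral>\<^sup>+s. ennreal ((poly Q s)\<^sup>2) * indicator {- S..S} s \<partial>lborel)"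
    unfolding C1_def using S by (intro poly_christoffel_interval Q(1)) auto
  moreover have "poly Q 0 = f x" using Q(2)[of 0] by (simp add: q_def g_def)
  ultimately have along: "ennreal (S * (f x)\<^sup>2)
      \<le> ennreal C1 * (\<integral>\<^sup>+s. ennreal ((q s)\<^sup>2) * indicator {- S..S} s \<partial>lborel)"
    using S by (simp add: Q(2))

  \<comment> \<open>The inequality on the segment over \<open>s\<close>, at its point \<open>t = \<delta> + s\<^sup>2/M\<^sup>2\<close> on the parabola.\<close>
  have across: "ennreal W * (ennreal ((q s)\<^sup>2) * indicator {- S..S} s)
      \<le> ennreal C2 * (\<integral>\<^sup>+t. F (g s t) \<partial>lborel)" for s
  proof (cases "s \<in> {- S..S}")
    case True
    define a where "a = \<delta> / 2 + s\<^sup>2 / M\<^sup>2"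
    obtain p where "degree p \<le> 1 * n" and p: "\<And>t. f (g s t) = poly p t"
      by (rule poly_fun_on_curve[OF f, of "[:x $ 1 + \<delta> * u $ 1 + s * v $ 1, - u $ 1:]" 1
            "[:x $ 2 + \<delta> * u $ 2 + s * v $ 2, - u $ 2:]" "g s"])
         (auto simp: g_def algebra_simps)
    then have p_deg: "degree p \<le> n" by simp
    have "s\<^sup>2 \<le> S\<^sup>2" using True by (simp add: abs_le_square_iff[symmetric] abs_le_iff)
    then have s2: "s\<^sup>2 / M\<^sup>2 \<le> \<beta> / 4"
      using M \<beta> by (simp add: S_def power_divide power_mult_distrib field_simps)
    have in_D: "g s t \<in> D" if "t \<in> {a..a + \<beta> / 2}" for t
      unfolding g_def
    proof (rule sub)
      have "0 \<le> s\<^sup>2 / M\<^sup>2" by simp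
      then have t: "s\<^sup>2 / M\<^sup>2 \<le> t" "0 \<le> t" "\<delta> / 2 \<le> t"
        using that \<delta>(1) unfolding a_def atLeastAtMost_iff by linarith+
      show "\<delta> / 2 \<le> t" by fact
      show "t \<le> \<beta>" using that s2 \<delta>(2) unfolding a_def atLeastAtMost_iff by linarith
      have "s\<^sup>2 \<le> (M * sqrt t)\<^sup>2"
        using t M by (simp add: power_mult_distrib field_simps)
      then show "\<bar>s\<bar> \<le> M * sqrt t"
        using M t by (simp add: abs_le_square_iff[symmetric] abs_mult)
    qed
    define y where "y = \<delta> + s\<^sup>2 / M\<^sup>2"
    have ya: "(y - a) * (a + \<beta> / 2 - y) = \<delta> / 2 * (\<beta> / 2 - \<delta> / 2)"
      by (simp add: y_def a_def field_simps)
    have "\<delta> / 2 * (\<beta> / 4) \<le> \<delta> / 2 * (\<beta> / 2 - \<delta> / 2)"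
      using \<delta> by (intro mult_left_mono) auto
    then have "W \<le> sqrt ((y - a) * (a + \<beta> / 2 - y))"
      unfolding W_def ya by simp
    then have "ennreal (W * (q s)\<^sup>2) \<le> ennreal (sqrt ((y - a) * (a + \<beta> / 2 - y)) * (poly p y)\<^sup>2)"
      unfolding q_def p y_def[symmetric] by (intro ennreal_leI mult_right_mono) auto
    also have "\<dots> \<le> ennreal C2 *
        (\<integral>\<^sup>+t. ennreal ((poly p t)\<^sup>2) * indicator {a..a + \<beta> / 2} t \<partial>lborel)"
      unfolding C2_def using \<delta> by (intro poly_christoffel_interval p_deg) (auto simp: y_def a_def)
    also have "\<dots> \<le> ennreal C2 * (\<integral>\<^sup>+t. F (g s t) \<partial>lborel)"
      using in_D by (intro mult_left_mono nn_integral_mono) (auto simp: F_def p split: split_indicator)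
    finally show ?thesis
      using True \<delta> \<beta> by (simp add: ennreal_mult' W_def)
  qed simp

  have meas: "(\<lambda>s. \<integral>\<^sup>+t. F (g s t) \<partial>lborel) \<in> borel_measurable lborel"
    unfolding g_def by measurable
  have q_meas: "(\<lambda>s. ennreal ((q s)\<^sup>2) * indicator {- S..S} s) \<in> borel_measurable lborel"
    unfolding Q(2) by measurable
  have "ennreal W * (\<integral>\<^sup>+s. ennreal ((q s)\<^sup>2) * indicator {- S..S} s \<partial>lborel)
      \<le> ennreal C2 * (\<integral>\<^sup>+s. \<integral>\<^sup>+t. F (g s t) \<partial>lborel \<partial>lborel)"
    unfolding nn_integral_cmult[OF meas, symmetric] nn_integral_cmult[OF q_meas, symmetric]
    by (intro nn_integral_mono across)
  also have "(\<integral>\<^sup>+s. \<integral>\<^sup>+t. F (g s t) \<partial>lborel \<partial>lborel) = (\<integral>\<^sup>+y. F y \<partial>lborel)"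
    using nn_integral_orthonormal_coordinates[of "- u" v F "x + \<delta> *\<^sub>R u"] uv F
    by (simp add: g_def algebra_simps)
  also have "\<dots> = ennreal (inner_on D f f)"
    unfolding F_def by (rule nn_integral_square_eq_inner_on[OF D f])
  finally have area: "ennreal W * (\<integral>\<^sup>+s. ennreal ((q s)\<^sup>2) * indicator {- S..S} s \<partial>lborel)
      \<le> ennreal C2 * ennreal (inner_on D f f)" .

  have "ennreal (W * (S * (f x)\<^sup>2)) = ennreal W * ennreal (S * (f x)\<^sup>2)"
    using \<delta> \<beta> by (intro ennreal_mult') (simp add: W_def)
  also have "\<dots> \<le> ennreal W * (ennreal C1 *
      (\<integral>\<^sup>+s. ennreal ((q s)\<^sup>2) * indicator {- S..S} s \<partial>lborel))"
    by (intro mult_left_mono along) simp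
  also have "\<dots> \<le> ennreal C1 * (ennreal C2 * ennreal (inner_on D f f))"
    using mult_left_mono[OF area, of "ennreal C1"] by (simp add: mult.left_commute)
  also have "\<dots> = ennreal (C1 * (C2 * inner_on D f f))"
    using C by (simp add: ennreal_mult' inner_on_self_nonneg)
  finally have main: "W * (S * (f x)\<^sup>2) \<le> C1 * (C2 * inner_on D f f)"
    using C by (simp add: inner_on_self_nonneg)

  \<comment> \<open>Numerical constants: \<open>\<surd>8 \<le> 3\<close>, \<open>\<pi> \<ge> 3\<close>, \<open>2n + 1 \<le> 3n\<close> and \<open>n + 1 \<le> 2n\<close> yield the factor
      \<open>64\<close>, rounded up to \<open>100\<close>.\<close>
  have "sqrt \<delta> * sqrt \<beta> / 3 \<le> W"
  proof -
    have "sqrt 8 \<le> (3::real)" by (rule real_le_lsqrt) auto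
    then have "sqrt \<delta> * sqrt \<beta> / 3 \<le> sqrt \<delta> * sqrt \<beta> / sqrt 8"
      using \<delta> \<beta> by (intro divide_left_mono) auto
    then show ?thesis by (simp add: W_def real_sqrt_mult real_sqrt_divide)
  qed
  then have "(sqrt \<delta> * sqrt \<beta> / 3) * (S * (f x)\<^sup>2) \<le> W * (S * (f x)\<^sup>2)"
    using S by (intro mult_right_mono) auto
  moreover have "(sqrt \<delta> * sqrt \<beta> / 3) * (S * (f x)\<^sup>2) = M * \<beta> * sqrt \<delta> / 6 * (f x)\<^sup>2"
  proof -
    have "sqrt \<beta> * sqrt \<beta> = \<beta>" using \<beta> by simp
    then show ?thesis unfolding S_def by (simp add: field_simps)
  qed
  moreover have "C1 * C2 \<le> 32 / 3 * (real n)\<^sup>2"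
  proof -
    have "C1 \<le> 4 * (3 * real n) / 3" unfolding C1_def using n pi_gt3 by (intro frac_le) auto
    moreover have "C2 \<le> 4 * (2 * real n) / 3" unfolding C2_def using n pi_gt3 by (intro frac_le) auto
    ultimately have "C1 * C2 \<le> (4 * (3 * real n) / 3) * (4 * (2 * real n) / 3)"
      by (intro mult_mono) (auto simp: C2_def)
    then show ?thesis by (simp add: power2_eq_square)
  qed
  then have "C1 * (C2 * inner_on D f f) \<le> 32 / 3 * (real n)\<^sup>2 * inner_on D f f"
    unfolding mult.assoc[symmetric] by (intro mult_right_mono inner_on_self_nonneg)
  ultimately have "M * \<beta> * sqrt \<delta> / 6 * (f x)\<^sup>2 \<le> 32 / 3 * (real n)\<^sup>2 * inner_on D f f"
    using main by linarith
  then have "M * \<beta> * sqrt \<delta> * (f x)\<^sup>2 \<le> 64 * ((real n)\<^sup>2 * inner_on D f f)" by simp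
  also have "\<dots> \<le> 100 * ((real n)\<^sup>2 * inner_on D f f)"
    by (intro mult_right_mono mult_nonneg_nonneg inner_on_self_nonneg) auto
  finally show ?thesis using n by (simp add: field_simps)
qed

lemma convex_line_mem:
  assumes D: "convex D" and "p + a *\<^sub>R v \<in> D" "p + b *\<^sub>R v \<in> D" and s: "a \<le> s" "s \<le> b"
  shows "p + s *\<^sub>R v \<in> D"
proof -
  have "convex {r. p + r *\<^sub>R v \<in> D}"
  proof (rule convexI)
    fix r r' c c' :: real
    assume r: "r \<in> {r. p + r *\<^sub>R v \<in> D}" "r' \<in> {r. p + r *\<^sub>R v \<in> D}"
      and c: "0 \<le> c" "0 \<le> c'" "c + c' = 1"
    have "c *\<^sub>R (p + r *\<^sub>R v) + c' *\<^sub>R (p + r' *\<^sub>R v) \<in> D"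
      using r c by (intro convexD[OF D]) auto
    also have "c *\<^sub>R (p + r *\<^sub>R v) + c' *\<^sub>R (p + r' *\<^sub>R v)
        = (c + c') *\<^sub>R p + (c * r + c' * r') *\<^sub>R v"
      by (simp add: algebra_simps)
    finally show "c *\<^sub>R r + c' *\<^sub>R r' \<in> {r. p + r *\<^sub>R v \<in> D}" using c by simp
  qed
  then have "is_interval {r. p + r *\<^sub>R v \<in> D}" by (simp add: is_interval_convex_1)
  then show ?thesis
    unfolding is_interval_1 using assms(2,3) s by blast
qed

text \<open>A finite lower bound for \<^const>\<open>side_length\<close> excludes the value \<open>-\<infinity>\<close>, so the line meets \<open>D\<close>
  and both maxima are attained; by convexity \<open>D\<close> contains the segment between the two end points.\<close>

lemma mem_of_side_length_ge:
  assumes D: "convex D" "compact D" and v: "norm v = 1" and r: "\<bar>s\<bar> \<le> r"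
    and side: "\<And>i. i \<in> {1, 2} \<Longrightarrow> ereal r \<le> side_length D x u v i t"
  shows "x + (dist_along D x u - t) *\<^sub>R u + s *\<^sub>R v \<in> D"
proof -
  have "\<exists>m\<ge>r. x + (dist_along D x u - t) *\<^sub>R u + ((-1) ^ i * m) *\<^sub>R v \<in> D" if "i \<in> {1, 2}" for i
  proof -
    let ?S = "{s. x + (dist_along D x u - t) *\<^sub>R u + ((-1) ^ i * s) *\<^sub>R v \<in> D}"
    have "?S \<noteq> {}"
    proof
      assume "?S = {}"
      then have "side_length D x u v i t = - \<infinity>"
        unfolding side_length_def by (simp only: SUP_empty bot_ereal_def)
      then show False using side[OF that] by simp
    qed
    then obtain s0 where "x + (dist_along D x u - t) *\<^sub>R u + ((-1) ^ i * s0) *\<^sub>R v \<in> D" by blast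
    from side_length_max[OF D(2) v this] side[OF that] show ?thesis by (metis ereal_less_eq(3))
  qed
  from this[of 1] this[of 2] obtain m1 m2 where m: "r \<le> m1" "r \<le> m2"
    "x + (dist_along D x u - t) *\<^sub>R u + (- m1) *\<^sub>R v \<in> D"
    "x + (dist_along D x u - t) *\<^sub>R u + m2 *\<^sub>R v \<in> D"
    by auto
  show ?thesis
    by (rule convex_line_mem[OF D(1) m(3,4)]) (use m(1,2) r in auto)
qed

section \<open>The lower bound for the Christoffel function\<close>

theorem theorem1:
  fixes \<beta> \<sigma> :: real
  assumes "\<beta> > 0" and "\<sigma> > 0"
  shows "\<exists>c>0. \<forall>(D :: (real^2) set) (x :: real^2) (u :: real^2) (v :: real^2) (n :: nat).
    convex D \<longrightarrow> compact D \<longrightarrow> interior D \<noteq> {} \<longrightarrow> x \<in> D - frontier D \<longrightarrow>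
    norm u = 1 \<longrightarrow> norm v = 1 \<longrightarrow> u \<bullet> v = 0 \<longrightarrow> n \<ge> 1 \<longrightarrow>
    \<sigma> / (real n)\<^sup>2 < dist_along D x u \<longrightarrow> dist_along D x u < \<beta> / 2 \<longrightarrow>
    ereal (christoffel n D x) \<ge>
      ereal (c / (real n)\<^sup>2 * sqrt (dist_along D x u)) *
      (INF i\<in>{1::nat, 2}. INF t\<in>{dist_along D x u / 2..\<beta>}.
         side_length D x u v i t / ereal (sqrt t))"
proof (intro exI[of _ "\<beta> / 100"] conjI allI impI)
  show "0 < \<beta> / 100" using assms by simp
  fix D :: "(real^2) set" and x u v :: "real^2" and n :: nat
  assume D: "convex D" "compact D" "interior D \<noteq> {}" and uv: "norm u = 1" "norm v = 1" "u \<bullet> v = 0"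
    and n: "n \<ge> 1" and lower: "\<sigma> / (real n)\<^sup>2 < dist_along D x u"
    and upper: "dist_along D x u < \<beta> / 2"
  define \<delta> where "\<delta> = dist_along D x u"
  define I where "I = (INF i\<in>{1::nat, 2}. INF t\<in>{\<delta> / 2..\<beta>}. side_length D x u v i t / ereal (sqrt t))"
  define A where "A = \<beta> / 100 / (real n)\<^sup>2 * sqrt \<delta>"
  have "0 \<le> \<sigma> / (real n)\<^sup>2" using assms by simp
  then have \<delta>: "0 < \<delta>" "\<delta> < \<beta> / 2" using lower upper unfolding \<delta>_def by linarith+
  have A: "0 < A" using assms(1) \<delta> n by (simp add: A_def)
  \<comment> \<open>Real lower bounds \<open>M\<close> suffice: if \<open>I\<close> were \<open>\<infinity>\<close>, all positive \<open>M\<close> would be admissible and the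
      value of the Christoffel function would exceed every real number.\<close>
  have bound: "A * M \<le> christoffel n D x" if M: "0 < M" "ereal M \<le> I" for M
  proof (rule le_christoffel[OF D(2,3)])
    fix f assume f: "f \<in> poly_fun n"
    have "x + (\<delta> - t) *\<^sub>R u + s *\<^sub>R v \<in> D"
      if t: "\<delta> / 2 \<le> t" "t \<le> \<beta>" and s: "\<bar>s\<bar> \<le> M * sqrt t" for s t
      unfolding \<delta>_def
    proof (rule mem_of_side_length_ge[OF D(1,2) uv(2) s])
      fix i :: nat assume i: "i \<in> {1, 2}"
      have "I \<le> side_length D x u v i t / ereal (sqrt t)"
        unfolding I_def by (rule INF_lower2[OF i]) (rule INF_lower, use t in simp)
      with M(2) have "ereal M \<le> side_length D x u v i t / ereal (sqrt t)" by (rule order_trans)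
      then have "ereal (sqrt t) * ereal M \<le> side_length D x u v i t"
        using t \<delta> by (subst (asm) ereal_le_divide_pos) auto
      then show "ereal (M * sqrt t) \<le> side_length D x u v i t" by (simp add: mult.commute)
    qed
    from parabolic_christoffel_bound[OF D(2) uv n M(1) \<delta> this f]
    show "A * M * (f x)\<^sup>2 \<le> inner_on D f f" by (simp add: A_def mult_ac)
  qed
  have "ereal A * I \<le> ereal (christoffel n D x)"
  proof (cases "I \<le> 0")
    case True
    then have "ereal A * I \<le> 0" using A by (simp add: ereal_mult_le_0_iff)
    also have "0 \<le> ereal (christoffel n D x)" by (simp add: christoffel_nonneg)
    finally show ?thesis .
  next
    case False
    show ?thesis
    proof (cases I)
      case (real r)
      then show ?thesis using bound[of r] False by simp
    next
      case PInf
      have "A * ((christoffel n D x + 1) / A) \<le> christoffel n D x"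
        using A christoffel_nonneg[of n D x] by (intro bound) (auto simp: PInf)
      then show ?thesis using A by simp
    next
      case MInf
      then show ?thesis using False by simp
    qed
  qed
  then show "ereal (\<beta> / 100 / (real n)\<^sup>2 * sqrt (dist_along D x u)) *
      (INF i\<in>{1::nat, 2}. INF t\<in>{dist_along D x u / 2..\<beta>}. side_length D x u v i t / ereal (sqrt t))
      \<le> ereal (christoffel n D x)"
    unfolding A_def I_def \<delta>_def .
qed

end
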